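(* The smallest order (number of vertices) of a triangle-free planar graph $G$ with $\chi_1(G)=3$ is $11$; that is, $f(3,1;\mathrm{planar})=11$.
   Context: All graphs are finite, undirected, with no loops or multiple edges. For a nonnegative integer $k$, a subset $U\subseteq V(G)$ is $k$-independent if the induced subgraph $G[U]$ has maximum degree at most $k$. A graph $G$ is $(m,k)$-colourable if its vertices can be assigned $m$ colours (one colour per vertex) so that for each colour the set of all vertices receiving that colour is $k$-independent. The $k$-defective chromatic number $\chi_k(G)$ is the smallest integer $m$ for which $G$ is $(m,k)$-colourable. $f(m,k;\mathrm{planar})$ denotes the smallest order of a triangle-free planar graph $G$ with $\chi_k(G)=m$. *)

theory Defs
  imports "HOL-Analysis.Analysis" "Graph_Theory.Pair_Digraph" "Graph_Theory.Digraph_Component"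
begin

text \<open>
  A finite, undirected graph without loops or multiple edges is a symmetric, loop-free finite
  digraph \<open>G\<close> with \<open>pair_graph G\<close>: an edge \<open>uv\<close> is the pair of arcs \<open>(u, v)\<close>, \<open>(v, u)\<close>.
  The degree of a vertex is thus its \<open>out_degree\<close>.
\<close>

definition edges :: "'a pair_pre_digraph \<Rightarrow> 'a set set" where
  "edges G = {{u, v} | u v. (u, v) \<in> parcs G}"

definition triangle_free :: "'a pair_pre_digraph \<Rightarrow> bool" where
  "triangle_free G \<longleftrightarrow>
     \<not> (\<exists>u v w. {u, v} \<in> edges G \<and> {v, w} \<in> edges G \<and> {w, u} \<in> edges G
               \<and> u \<noteq> v \<and> v \<noteq> w \<and> w \<noteq> u)"

text \<open>
  A planar graph is one with a drawing in the plane: \<open>p\<close> places the vertices at distinct points,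
  \<open>\<gamma>\<close> assigns to each edge a simple (injective, continuous) arc joining its two end points which
  avoids all other vertices, and distinct edges meet at most in the points of common end vertices.
\<close>

definition planar :: "'a pair_pre_digraph \<Rightarrow> bool" where
  "planar G \<longleftrightarrow>
     (\<exists>(p :: 'a \<Rightarrow> complex) (\<gamma> :: 'a set \<Rightarrow> real \<Rightarrow> complex).
        inj_on p (pverts G) \<and>
        (\<forall>e \<in> edges G. arc (\<gamma> e) \<and> {pathstart (\<gamma> e), pathfinish (\<gamma> e)} = p ` e
                        \<and> path_image (\<gamma> e) \<inter> p ` pverts G = p ` e) \<and>
        (\<forall>e \<in> edges G. \<forall>f \<in> edges G. e \<noteq> f \<longrightarrow>
             path_image (\<gamma> e) \<inter> path_image (\<gamma> f) \<subseteq> p ` (e \<inter> f)))"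

definition k_independent :: "nat \<Rightarrow> 'a pair_pre_digraph \<Rightarrow> 'a set \<Rightarrow> bool" where
  "k_independent k G U \<longleftrightarrow>
     U \<subseteq> pverts G \<and> (\<forall>u \<in> U. out_degree (with_proj G \<restriction> U) u \<le> k)"

definition defective_colourable :: "nat \<Rightarrow> nat \<Rightarrow> 'a pair_pre_digraph \<Rightarrow> bool" where
  "defective_colourable m k G \<longleftrightarrow>
     (\<exists>c :: 'a \<Rightarrow> nat. (\<forall>v \<in> pverts G. c v < m) \<and>
        (\<forall>i < m. k_independent k G {v \<in> pverts G. c v = i}))"

definition defective_chromatic_number :: "nat \<Rightarrow> 'a pair_pre_digraph \<Rightarrow> nat" where
  "defective_chromatic_number k G = (LEAST m. defective_colourable m k G)"

text \<open>
  Every finite graph is isomorphic to one whose vertices are natural numbers, so the smallest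
  order may be taken over graphs of type \<open>nat pair_pre_digraph\<close>.
\<close>

definition f_planar :: "nat \<Rightarrow> nat \<Rightarrow> nat" where
  "f_planar m k =
     (LEAST n. \<exists>G :: nat pair_pre_digraph. pair_graph G \<and> triangle_free G \<and> planar G
                 \<and> defective_chromatic_number k G = m \<and> card (pverts G) = n)"

end

theory Submission
  imports Defs
begin

text \<open>
  Lower bound.  A plane drawing contains no subdivision of \<open>K\<^sub>3\<^sub>,\<^sub>3\<close>: two of the three paths between
  two branch points form a Jordan curve, and Janiszewski's theorem shows that no point can see all
  three paths.  So let a triangle-free graph on at most ten vertices have no \<open>(2,1)\<close>-colouring.
  A maximum cut leaves every vertex of degree at most 3 with at most one neighbour on its own side,
  hence some vertex \<open>v\<close> has four neighbours; as \<open>N(v)\<close> is independent, the complement of \<open>N(v)\<close>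
  contains a path on three vertices, none of them \<open>v\<close>.  With these eight vertices named, the 55
  colourings and 87 subdivisions of \<open>K\<^sub>3\<^sub>,\<^sub>3\<close> listed below are propositionally inconsistent.

  Upper bound.  In the extremal graph the pairs \<open>{0,1}\<close>, \<open>{0,2}\<close>, \<open>{1,3}\<close> are joined by
  3, 2 and 2 paths of length two, and \<open>0-3-2-1\<close> is a path; it is drawn with straight lines.
\<close>

section \<open>Defective colourings\<close>

text \<open>For a graph, a set is 1-independent exactly when it contains no cherry. The definition
  takes a bare relation so that it also applies to relations on indices.\<close>

definition cherry :: "('a \<Rightarrow> 'a \<Rightarrow> bool) \<Rightarrow> 'a set \<Rightarrow> bool" where
  "cherry E S \<longleftrightarrow> (\<exists>v\<in>S. \<exists>i\<in>S. \<exists>k\<in>S. i \<noteq> k \<and> E v i \<and> E v k)"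

abbreviation adj :: "'a pair_pre_digraph \<Rightarrow> 'a \<Rightarrow> 'a \<Rightarrow> bool" where
  "adj G u v \<equiv> (u, v) \<in> parcs G"

lemma k_independent_1_iff:
  assumes "pair_graph G"
  shows "k_independent 1 G U \<longleftrightarrow> U \<subseteq> pverts G \<and> \<not> cherry (adj G) U"
proof -
  interpret pair_graph G by fact
  have "out_degree (with_proj G \<restriction> U) u \<le> 1 \<longleftrightarrow> (\<forall>i\<in>U. \<forall>k\<in>U. adj G u i \<longrightarrow> adj G u k \<longrightarrow> i = k)"
    if "u \<in> U" for u
  proof -
    let ?N = "{i \<in> U. adj G u i}"
    have "out_arcs (with_proj G \<restriction> U) u = Pair u ` ?N"
      using that by (auto simp: out_arcs_def induce_subgraph_def)
    then have "out_degree (with_proj G \<restriction> U) u = card ?N"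
      by (simp add: out_degree_def card_image inj_on_def)
    moreover have "finite ?N"
      by (rule finite_subset[OF _ pair_finite_verts]) (auto dest: wellformed')
    ultimately show ?thesis
      by (auto simp: card_le_Suc0_iff_eq)
  qed
  then have "(\<forall>u\<in>U. out_degree (with_proj G \<restriction> U) u \<le> 1) \<longleftrightarrow> \<not> cherry (adj G) U"
    by (simp add: cherry_def) blast
  then show ?thesis by (simp only: k_independent_def)
qed

lemma defective_colourable_1_iff:
  fixes G :: "'a pair_pre_digraph"
  assumes "pair_graph G"
  shows "defective_colourable m 1 G \<longleftrightarrow> (\<exists>c :: 'a \<Rightarrow> nat. (\<forall>v\<in>pverts G. c v < m) \<and>
    (\<forall>i<m. \<not> cherry (adj G) {v \<in> pverts G. c v = i}))"
  unfolding defective_colourable_def k_independent_1_iff[OF assms] by auto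

lemma defective_colourable_mono:
  assumes "defective_colourable m k G" "m \<le> n"
  shows "defective_colourable n k G"
proof -
  obtain c where c: "\<forall>v\<in>pverts G. c v < m" "\<forall>i<m. k_independent k G {v \<in> pverts G. c v = i}"
    using assms(1) unfolding defective_colourable_def by blast
  have "k_independent k G {v \<in> pverts G. c v = i}" for i
  proof (cases "i < m")
    case False
    then have "{v \<in> pverts G. c v = i} = {}" using c(1) by auto
    then show ?thesis by (simp only: k_independent_def) simp
  qed (use c in auto)
  then show ?thesis
    using c(1) assms(2) unfolding defective_colourable_def by (meson order_less_le_trans)
qed

lemma defective_colourable_2_1_iff:
  fixes G :: "'a pair_pre_digraph"
  assumes "pair_graph G"
  shows "defective_colourable 2 1 G \<longleftrightarrow>
    (\<exists>A \<subseteq> pverts G. \<not> cherry (adj G) A \<and> \<not> cherry (adj G) (pverts G - A))"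
  unfolding defective_colourable_1_iff[OF assms]
proof
  assume "\<exists>A \<subseteq> pverts G. \<not> cherry (adj G) A \<and> \<not> cherry (adj G) (pverts G - A)"
  then obtain A where A: "A \<subseteq> pverts G" "\<not> cherry (adj G) A" "\<not> cherry (adj G) (pverts G - A)" by blast
  have "{v \<in> pverts G. (if v \<in> A then 0 else 1) = (0::nat)} = A"
    "{v \<in> pverts G. (if v \<in> A then 0 else 1) = (1::nat)} = pverts G - A" using A(1) by auto
  then show "\<exists>c :: 'a \<Rightarrow> nat. (\<forall>v\<in>pverts G. c v < 2) \<and> (\<forall>i<2. \<not> cherry (adj G) {v \<in> pverts G. c v = i})"
    using A by (intro exI[of _ "\<lambda>v. if v \<in> A then 0 else 1"]) (auto simp: less_2_cases_iff)
next
  assume "\<exists>c :: 'a \<Rightarrow> nat. (\<forall>v\<in>pverts G. c v < 2) \<and> (\<forall>i<2. \<not> cherry (adj G) {v \<in> pverts G. c v = i})"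
  then obtain c :: "'a \<Rightarrow> nat" where c: "\<forall>v\<in>pverts G. c v < 2" "\<forall>i<2. \<not> cherry (adj G) {v \<in> pverts G. c v = i}" by blast
  have "pverts G - {v \<in> pverts G. c v = 0} = {v \<in> pverts G. c v = 1}" using c(1) by (auto simp: less_2_cases_iff)
  then show "\<exists>A \<subseteq> pverts G. \<not> cherry (adj G) A \<and> \<not> cherry (adj G) (pverts G - A)"
    using c(2) by (intro exI[of _ "{v \<in> pverts G. c v = 0}"]) auto
qed

lemma pair_graph_facts:
  assumes "pair_graph G"
  shows pair_graph_finite: "finite (pverts G)"
    and pair_graph_sym: "adj G u v \<longleftrightarrow> adj G v u"
    and pair_graph_irrefl: "\<not> adj G u u"
    and pair_graph_wf: "adj G u v \<Longrightarrow> u \<in> pverts G \<and> v \<in> pverts G"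
    and pair_graph_edges: "{u, v} \<in> edges G \<longleftrightarrow> adj G u v"
proof -
  interpret pair_graph G by fact
  show "finite (pverts G)" by (rule pair_finite_verts)
  show sym: "adj G u v \<longleftrightarrow> adj G v u" for u v
    using pair_sym_arcs by (auto simp: symmetric_def dest: symD)
  show "\<not> adj G u u" using no_loops' by blast
  show "adj G u v \<Longrightarrow> u \<in> pverts G \<and> v \<in> pverts G" using wellformed' by blast
  show "{u, v} \<in> edges G \<longleftrightarrow> adj G u v"
    using sym by (auto simp: edges_def doubleton_eq_iff)
qed

lemma triangle_free_iff:
  assumes "pair_graph G"
  shows "triangle_free G \<longleftrightarrow> \<not> (\<exists>u v w. adj G u v \<and> adj G v w \<and> adj G u w)"
  unfolding triangle_free_def pair_graph_edges[OF assms]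
  using pair_graph_sym[OF assms] pair_graph_irrefl[OF assms] by metis

section \<open>Subdivisions of \<open>K\<^sub>3\<^sub>,\<^sub>3\<close> are not planar\<close>

text \<open>
  Let \<open>D\<close> be the side of the Jordan curve \<open>A\<^sub>1 \<union> A\<^sub>2\<close> not containing \<open>p\<close>; it misses \<open>A\<^sub>3\<close>.  Points of \<open>D\<close>
  close to \<open>q\<^sub>1\<close> and to \<open>q\<^sub>2\<close> can be joined to \<open>p\<close> off \<open>A\<^sub>2 \<union> A\<^sub>3\<close> and off \<open>A\<^sub>1 \<union> A\<^sub>3\<close>, respectively, and to
  each other in \<open>D\<close>, so Janiszewski's theorem joins \<open>D\<close> to \<open>p\<close> off all three sets.
\<close>

lemma theta_no_common_face:
  fixes A\<^sub>1 A\<^sub>2 A\<^sub>3 :: "complex set"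
  assumes c: "simple_path c" "pathfinish c = pathstart c" "path_image c = A\<^sub>1 \<union> A\<^sub>2"
    and compact: "compact A\<^sub>1" "compact A\<^sub>2" "compact A\<^sub>3"
    and conn: "Topological_Spaces.connected A\<^sub>3"
      "Topological_Spaces.connected (A\<^sub>3 - (A\<^sub>1 \<union> A\<^sub>2))"
    and sub: "A\<^sub>1 \<inter> A\<^sub>2 \<subseteq> A\<^sub>3"
    and q: "q\<^sub>1 \<in> A\<^sub>1" "q\<^sub>2 \<in> A\<^sub>2" "q\<^sub>3 \<in> A\<^sub>3"
    and p1: "connected_component (- (A\<^sub>2 \<union> A\<^sub>3)) p q\<^sub>1"
    and p2: "connected_component (- (A\<^sub>1 \<union> A\<^sub>3)) p q\<^sub>2"
    and p3: "connected_component (- (A\<^sub>1 \<union> A\<^sub>2)) p q\<^sub>3"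
  shows False
proof -
  have split: "\<exists>D F. p \<in> F \<and> open D \<and> Topological_Spaces.connected D \<and> open F \<and> D \<inter> F = {}
      \<and> D \<union> F = - (A\<^sub>1 \<union> A\<^sub>2) \<and> frontier D = A\<^sub>1 \<union> A\<^sub>2"
  proof -
    obtain inner outer where
      *: "open inner" "Topological_Spaces.connected inner" "open outer" "Topological_Spaces.connected outer"
         "inner \<inter> outer = {}"
         "inner \<union> outer = - path_image c" "frontier inner = path_image c" "frontier outer = path_image c"
      using Jordan_curve[OF c(1,2)] by metis
    have "p \<in> inner \<union> outer" using connected_component_in[OF p3] * c(3) by auto
    then show ?thesis
    proof
      assume "p \<in> inner"
      then show ?thesis by (intro exI[of _ outer] exI[of _ inner]) (use * c(3) in auto)
    next
      assume "p \<in> outer"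
      then show ?thesis by (intro exI[of _ inner] exI[of _ outer]) (use * c(3) in auto)
    qed
  qed
  then obtain D F where F: "p \<in> F" "open F" and D: "open D" "Topological_Spaces.connected D"
    and DF: "D \<inter> F = {}" "D \<union> F = - (A\<^sub>1 \<union> A\<^sub>2)" and fr: "frontier D = A\<^sub>1 \<union> A\<^sub>2" by blast
  \<comment> \<open>\<open>D\<close> and \<open>F\<close> separate the complement of the curve: a
    connected set off the curve that meets \<open>F\<close> cannot reach \<open>D\<close>.\<close>
  have stay: "U \<inter> D = {}" if "Topological_Spaces.connected U" "U \<subseteq> - (A\<^sub>1 \<union> A\<^sub>2)" "U \<inter> F \<noteq> {}" for U
    using connectedD[OF that(1) D(1) F(2)] that(2,3) DF by blast
  have "q\<^sub>3 \<in> F"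
  proof -
    obtain U where "Topological_Spaces.connected U" "U \<subseteq> - (A\<^sub>1 \<union> A\<^sub>2)" "p \<in> U" "q\<^sub>3 \<in> U"
      using p3 unfolding connected_component_def by blast
    then show ?thesis using stay[of U] F(1) DF(2) by blast
  qed
  then have "(A\<^sub>3 - (A\<^sub>1 \<union> A\<^sub>2)) \<inter> D = {}"
    using stay[OF conn(2)] q(3) DF by blast+
  then have D3: "D \<inter> A\<^sub>3 = {}" using DF by blast
  \<comment> \<open>Every point of the curve is a frontier point of \<open>D\<close>, so a small
    ball around \<open>q\<close> that misses \<open>T\<close> contains a point of
    \<open>D\<close>.\<close>
  have near: "\<exists>d\<in>D. connected_component (- T) p d"
    if q: "q \<in> A\<^sub>1 \<union> A\<^sub>2" and T: "closed T" and pq: "connected_component (- T) p q" for q T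
  proof -
    obtain e where e: "e > 0" "ball q e \<subseteq> - T"
      using connected_component_in[OF pq] T by (metis open_contains_ball open_Compl)
    have "q \<in> closure D" using q fr by (auto simp: frontier_def)
    then obtain d where d: "d \<in> D" "d \<in> ball q e" using e(1)
      by (metis closure_approachable dist_commute mem_ball)
    then have "connected_component (- T) q d"
      using e unfolding connected_component_def by (meson centre_in_ball connected_ball)
    then show ?thesis using pq d(1) by (meson connected_component_trans)
  qed
  have cl: "closed A\<^sub>1" "closed A\<^sub>2" "closed A\<^sub>3" using compact by (auto intro: compact_imp_closed)
  obtain d1 where d1: "d1 \<in> D" "connected_component (- (A\<^sub>2 \<union> A\<^sub>3)) p d1"
    using near[OF _ _ p1] q cl by auto
  obtain d2 where d2: "d2 \<in> D" "connected_component (- (A\<^sub>1 \<union> A\<^sub>3)) p d2"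
    using near[OF _ _ p2] q cl by auto
  have "connected_component (- (A\<^sub>1 \<union> A\<^sub>3)) d2 d1"
    unfolding connected_component_def using D d1 d2 DF D3 by (intro exI[of _ D]) auto
  then have d1': "connected_component (- (A\<^sub>1 \<union> A\<^sub>3)) p d1"
    using d2(2) by (meson connected_component_trans)
  \<comment> \<open>The two obstacles meet exactly in the connected set \<open>A\<^sub>3\<close>,
    which is what Janiszewski's theorem asks for.\<close>
  have "(A\<^sub>2 \<union> A\<^sub>3) \<inter> (A\<^sub>1 \<union> A\<^sub>3) = A\<^sub>3" using sub by auto
  then have "connected_component (- ((A\<^sub>2 \<union> A\<^sub>3) \<union> (A\<^sub>1 \<union> A\<^sub>3))) p d1"
    using Janiszewski[OF _ _ _ d1(2) d1'] compact cl conn(1) by auto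
  then obtain U where "Topological_Spaces.connected U" "U \<subseteq> - (A\<^sub>1 \<union> A\<^sub>2)" "p \<in> U" "d1 \<in> U"
    unfolding connected_component_def by blast
  then show False using stay[of U] F(1) d1(1) by blast
qed

text \<open>The three paths from \<open>s 0\<close> through \<open>t j\<close> to \<open>s 1\<close>
  form a theta curve. From \<open>s 2\<close> the arcs \<open>g 2 j\<close> reach a point
  \<open>t j\<close> on each of them while avoiding the other two, contrary to
  \<open>theta_no_common_face\<close>.\<close>

lemma K33_not_planar_arcs:
  fixes s t :: "nat \<Rightarrow> complex" and g :: "nat \<Rightarrow> nat \<Rightarrow> real \<Rightarrow> complex"
  assumes arcs: "\<And>i j. i < 3 \<Longrightarrow> j < 3 \<Longrightarrow> arc (g i j) \<and> pathstart (g i j) = s i \<and> pathfinish (g i j) = t j"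
    and meet: "\<And>i j k l. i < 3 \<Longrightarrow> j < 3 \<Longrightarrow> k < 3 \<Longrightarrow> l < 3 \<Longrightarrow> (i, j) \<noteq> (k, l) \<Longrightarrow>
      path_image (g i j) \<inter> path_image (g k l) \<subseteq> {z. i = k \<and> z = s i \<or> j = l \<and> z = t j}"
  shows False
proof -
  have ends: "s i \<in> path_image (g i j)" "t j \<in> path_image (g i j)" if "i < 3" "j < 3" for i j
    using arcs[OF that] by (metis pathstart_in_path_image, metis pathfinish_in_path_image)
  have st: "s i \<noteq> t j" if "i < 3" "j < 3" for i j
    using arcs[OF that] arc_distinct_ends by metis
  have s: "s i \<noteq> s k" if "i < 3" "k < 3" "i \<noteq> k" for i k
    using meet[of i 0 k 1] ends[of i 0] ends[of k 1] that by auto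
  have t: "t j \<noteq> t l" if "j < 3" "l < 3" "j \<noteq> l" for j l
    using meet[of 0 j 1 l] ends[of 0 j] ends[of 1 l] that by auto
  define h where "h j = g 0 j +++ reversepath (g 1 j)" for j
  define A where "A j = path_image (g 0 j) \<union> path_image (g 1 j)" for j
  have h: "arc (h j)" "pathstart (h j) = s 0" "pathfinish (h j) = s 1" "path_image (h j) = A j" if "j < 3" for j
  proof -
    have "arc (g 0 j)" "arc (g 1 j)" using arcs[of 0 j] arcs[of 1 j] that by auto
    moreover have "path_image (g 0 j) \<inter> path_image (g 1 j) \<subseteq> {t j}" using meet[of 0 j 1 j] that by auto
    ultimately show "arc (h j)" "pathstart (h j) = s 0" "pathfinish (h j) = s 1" "path_image (h j) = A j"
      using arcs[of 0 j] arcs[of 1 j] that unfolding h_def A_def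
      by (auto intro!: arc_join simp: arc_reversepath path_image_join)
  qed
  have AA: "A j \<inter> A l = {s 0, s 1}" if "j < 3" "l < 3" "j \<noteq> l" for j l
  proof
    show "A j \<inter> A l \<subseteq> {s 0, s 1}"
      using meet[of 0 j 0 l] meet[of 0 j 1 l] meet[of 1 j 0 l] meet[of 1 j 1 l] that
      unfolding A_def by auto
    show "{s 0, s 1} \<subseteq> A j \<inter> A l" using ends that unfolding A_def by auto
  qed
  have sA: "s 2 \<notin> A j" if "j < 3" for j
  proof -
    \<comment> \<open>\<open>s 2\<close> lies on the arc to some \<open>t l\<close> with
      \<open>l\<close> different from \<open>j\<close>. That arc shares no end with the two arcs
      forming \<open>A j\<close>, so it is disjoint from them.\<close>
    define l :: nat where "l = (if j = 0 then 1 else 0)"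
    have l: "l < 3" "l \<noteq> j" by (auto simp: l_def)
    show ?thesis
      using meet[of 2 l 0 j] meet[of 2 l 1 j] ends(1)[of 2 l] that l unfolding A_def by auto
  qed
  have tA: "t j \<in> A j" if "j < 3" for j using ends[of 0 j] that by (auto simp: A_def)
  have g2: "path_image (g 2 j) \<inter> A l = {}" if "j < 3" "l < 3" "j \<noteq> l" for j l
    using meet[of 2 j 0 l] meet[of 2 j 1 l] that unfolding A_def by auto
  have cc: "connected_component (- (A k \<union> A l)) (s 2) (t j)"
    if "j < 3" "k < 3" "l < 3" "j \<noteq> k" "j \<noteq> l" for j k l
    unfolding connected_component_def
    using g2[of j k] g2[of j l] ends[of 2 j] arcs[of 2 j] that
    by (intro exI[of _ "path_image (g 2 j)"]) (auto intro: connected_arc_image)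
  show False
  proof (rule theta_no_common_face[of "h 0 +++ reversepath (h 1)" "A 0" "A 1" "A 2" "t 0" "t 1" "t 2" "s 2"])
    show "simple_path (h 0 +++ reversepath (h 1))"
      using h[of 0] h[of 1] AA[of 0 1] by (intro simple_path_join_loop) (auto simp: arc_reversepath)
    show "pathfinish (h 0 +++ reversepath (h 1)) = pathstart (h 0 +++ reversepath (h 1))"
      using h[of 0] h[of 1] by simp
    show "path_image (h 0 +++ reversepath (h 1)) = A 0 \<union> A 1"
      using h[of 0] h[of 1] by (simp add: path_image_join)
    show "compact (A 0)" "compact (A 1)" "compact (A 2)"
      using compact_arc_image[OF h(1)] h(4) by force+
    show "Topological_Spaces.connected (A 2)"
      using h[of 2] connected_arc_image by fastforce
    \<comment> \<open>Off the other two paths, the third is an arc without its end points, hence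
      connected.\<close>
    have "A 2 - (A 0 \<union> A 1) = A 2 - {s 0, s 1}" using AA[of 2 0] AA[of 2 1] by auto
    then show "Topological_Spaces.connected (A 2 - (A 0 \<union> A 1))"
      using h[of 2] connected_simple_path_endless[of "h 2"] by (simp add: arc_imp_simple_path)
    show "A 0 \<inter> A 1 \<subseteq> A 2" using AA[of 0 1] AA[of 0 2] by auto
  qed (use tA cc in auto)
qed

text \<open>
  The branch vertices are \<open>s\<close> and \<open>t\<close>, and \<open>P ! i ! j\<close> lists the inner vertices of the path from
  \<open>s ! i\<close> to \<open>t ! j\<close>.
\<close>

definition K33_subdivision :: "('a \<Rightarrow> 'a \<Rightarrow> bool) \<Rightarrow> 'a list \<Rightarrow> 'a list \<Rightarrow> 'a list list list \<Rightarrow> bool" where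
  "K33_subdivision E s t P \<longleftrightarrow> length s = 3 \<and> length t = 3 \<and> map length P = [3, 3, 3] \<and>
     distinct (s @ t @ concat (concat P)) \<and>
     (\<forall>i\<in>{0,1,2}. \<forall>j\<in>{0,1,2}. successively E (s ! i # P ! i ! j @ [t ! j]))"

lemma successively_map_imp:
  assumes "successively F xs" "\<And>i j. F i j \<Longrightarrow> E (f i) (f j)"
  shows "successively E (map f xs)"
  using assms by (simp add: successively_map successively_mono)

lemma successively_subset_field:
  assumes "successively F xs" "2 \<le> length xs" "\<And>i j. F i j \<Longrightarrow> i \<in> I \<and> j \<in> I"
  shows "set xs \<subseteq> I"
  using assms
proof (induction F xs rule: successively.induct)
  case (3 P x y xs)
  then show ?case by (cases xs) auto
qed auto

text \<open>Every vertex of a subdivision lies on an edge of \<open>F\<close>, hence in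
  \<open>I\<close>, where \<open>f\<close> is injective; so distinctness survives the map. This
  carries subdivisions found among indices over to the graph itself.\<close>

lemma K33_subdivision_map:
  assumes K: "K33_subdivision F s t P" and F: "\<And>i j. F i j \<Longrightarrow> i \<in> I \<and> j \<in> I \<and> E (f i) (f j)"
    and inj: "inj_on f I"
  shows "K33_subdivision E (map f s) (map f t) (map (map (map f)) P)"
proof -
  have len: "length s = 3" "length t = 3" "length P = 3" "\<And>i. i < 3 \<Longrightarrow> length (P ! i) = 3"
    using K by (auto simp: K33_subdivision_def less_Suc_eq numeral_3_eq_3 list_eq_iff_nth_eq[of "map length P"])
  have succ: "successively F (s ! i # P ! i ! j @ [t ! j])" if "i \<in> {0,1,2}" "j \<in> {0,1,2}" for i j
    using K that unfolding K33_subdivision_def by blast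
  have sub: "set (s ! i # P ! i ! j @ [t ! j]) \<subseteq> I" if "i \<in> {0,1,2}" "j \<in> {0,1,2}" for i j
    using successively_subset_field[OF succ[OF that], of I] F by auto
  have "set (s @ t @ concat (concat P)) \<subseteq> I"
  proof
    have lt: "i < 3 \<longleftrightarrow> i \<in> {0,1,2}" for i :: nat by auto
    fix z assume "z \<in> set (s @ t @ concat (concat P))"
    then consider "z \<in> set s" | "z \<in> set t" | Q where "Q \<in> set P" "z \<in> set (concat Q)" by auto
    then show "z \<in> I"
    proof cases
      case 1
      then obtain i where "i \<in> {0,1,2}" "z = s ! i" by (metis in_set_conv_nth len(1) lt)
      then show ?thesis using sub[of i 0] by simp
    next
      case 2
      then obtain i where "i \<in> {0,1,2}" "z = t ! i" by (metis in_set_conv_nth len(2) lt)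
      then show ?thesis using sub[of 0 i] by simp
    next
      case (3 Q)
      then obtain i where i: "i \<in> {0,1,2}" "Q = P ! i" by (metis in_set_conv_nth len(3) lt)
      obtain R where R: "R \<in> set Q" "z \<in> set R" using 3(2) by auto
      then obtain j where "j \<in> {0,1,2}" "R = Q ! j" by (metis in_set_conv_nth len(4) lt i)
      then show ?thesis using sub[of i j] i R by auto
    qed
  qed
  then have "inj_on f (set (s @ t @ concat (concat P)))" using inj by (rule inj_on_subset[rotated])
  moreover have "distinct (s @ t @ concat (concat P))" using K by (simp add: K33_subdivision_def)
  ultimately have "distinct (map f (s @ t @ concat (concat P)))" by (simp only: distinct_map)
  then have "distinct (map f s @ map f t @ concat (concat (map (map (map f)) P)))"
    by (simp only: map_append map_concat map_map comp_def)
  moreover have "successively E (map f s ! i # map (map (map f)) P ! i ! j @ [map f t ! j])"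
    if "i \<in> {0,1,2}" "j \<in> {0,1,2}" for i j
    using successively_map_imp[OF succ[OF that], of E f] F that len by auto
  moreover have "map length (map (map (map f)) P) = map length P" by (simp add: comp_def)
  ultimately show ?thesis using K unfolding K33_subdivision_def by simp
qed

section \<open>Vertex paths and the arcs that draw them\<close>

fun path_edges :: "'a list \<Rightarrow> 'a set set" where
  "path_edges (x # y # xs) = insert {x, y} (path_edges (y # xs))"
| "path_edges _ = {}"

lemma path_edges_subset: "e \<in> path_edges xs \<Longrightarrow> e \<subseteq> set xs"
  by (induction xs rule: path_edges.induct) auto

lemma path_edges_doubleton:
  "e \<in> path_edges xs \<Longrightarrow> distinct xs \<Longrightarrow> \<exists>u v. u \<noteq> v \<and> e = {u, v}"
  by (induction xs rule: path_edges.induct) auto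

lemma path_edges_edges: "successively (adj G) xs \<Longrightarrow> path_edges xs \<subseteq> edges G"
  by (induction xs rule: path_edges.induct) (auto simp: edges_def)

locale plane_drawing =
  fixes G :: "'a pair_pre_digraph" and p :: "'a \<Rightarrow> complex" and \<gamma> :: "'a set \<Rightarrow> real \<Rightarrow> complex"
  assumes inj: "inj_on p (pverts G)"
    and edge_arc: "e \<in> edges G \<Longrightarrow> arc (\<gamma> e)"
    and edge_ends: "e \<in> edges G \<Longrightarrow> {pathstart (\<gamma> e), pathfinish (\<gamma> e)} = p ` e"
    and edges_meet: "e \<in> edges G \<Longrightarrow> f \<in> edges G \<Longrightarrow> e \<noteq> f \<Longrightarrow>
      path_image (\<gamma> e) \<inter> path_image (\<gamma> f) \<subseteq> p ` (e \<inter> f)"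
begin

definition drawn :: "'a list \<Rightarrow> complex set" where
  "drawn xs = (\<Union>e\<in>path_edges xs. path_image (\<gamma> e))"

text \<open>A common point lies on an edge of each path. These edges are distinct, so in the drawing
  they meet only at images of common end vertices.\<close>

lemma drawn_Int:
  assumes "successively (adj G) xs" "successively (adj G) ys" "path_edges xs \<inter> path_edges ys = {}"
  shows "drawn xs \<inter> drawn ys \<subseteq> p ` (set xs \<inter> set ys)"
proof
  fix z assume "z \<in> drawn xs \<inter> drawn ys"
  then obtain e f where e: "e \<in> path_edges xs" "z \<in> path_image (\<gamma> e)"
    and f: "f \<in> path_edges ys" "z \<in> path_image (\<gamma> f)" unfolding drawn_def by blast
  then have "z \<in> p ` (e \<inter> f)"
    using edges_meet[of e f] path_edges_edges[OF assms(1)] path_edges_edges[OF assms(2)] assms(3) by blast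
  then show "z \<in> p ` (set xs \<inter> set ys)" using path_edges_subset e(1) f(1) by blast
qed

text \<open>Induction along the path: the first vertex does not recur, so the first edge meets the
  drawing of the remaining path only at their common vertex, and the two arcs can be joined.\<close>

lemma drawn_arc:
  assumes "successively (adj G) xs" "distinct xs" "2 \<le> length xs"
  shows "\<exists>g. arc g \<and> pathstart g = p (hd xs) \<and> pathfinish g = p (last xs) \<and> path_image g = drawn xs"
  using assms
proof (induction xs rule: path_edges.induct)
  case (1 x y xs)
  have xy: "{x, y} \<in> edges G" using "1.prems"(1) by (auto simp: edges_def)
  \<comment> \<open>The curve of an edge may run in either direction; it is reversed if
    necessary.\<close>
  have "\<exists>h. arc h \<and> pathstart h = p x \<and> pathfinish h = p y \<and> path_image h = path_image (\<gamma> {x, y})"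
  proof -
    have "pathstart (\<gamma> {x, y}) = p x \<and> pathfinish (\<gamma> {x, y}) = p y \<or>
        pathstart (\<gamma> {x, y}) = p y \<and> pathfinish (\<gamma> {x, y}) = p x"
      using edge_ends[OF xy] by (auto simp: doubleton_eq_iff)
    then show ?thesis
    proof
      assume "pathstart (\<gamma> {x, y}) = p x \<and> pathfinish (\<gamma> {x, y}) = p y"
      then show ?thesis using edge_arc[OF xy] by blast
    next
      assume "pathstart (\<gamma> {x, y}) = p y \<and> pathfinish (\<gamma> {x, y}) = p x"
      then show ?thesis using edge_arc[OF xy]
        by (intro exI[of _ "reversepath (\<gamma> {x, y})"]) (simp add: arc_reversepath)
    qed
  qed
  then obtain h where h: "arc h" "pathstart h = p x" "pathfinish h = p y" "path_image h = path_image (\<gamma> {x, y})"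
    by blast
  show ?case
  proof (cases xs)
    case Nil
    then show ?thesis using h by (intro exI[of _ h]) (simp add: drawn_def)
  next
    case (Cons z zs)
    then obtain g where g: "arc g" "pathstart g = p y" "pathfinish g = p (last (y # xs))" "path_image g = drawn (y # xs)"
      using 1 by auto
    have "{x, y} \<notin> path_edges (y # xs)" using path_edges_subset[of "{x, y}" "y # xs"] "1.prems"(2) by auto
    then have "drawn [x, y] \<inter> drawn (y # xs) \<subseteq> p ` (set [x, y] \<inter> set (y # xs))"
      using "1.prems"(1) by (intro drawn_Int) auto
    then have "path_image h \<inter> path_image g \<subseteq> {p y}"
      using "1.prems"(2) unfolding h(4) g(4) by (auto simp: drawn_def)
    then have "arc (h +++ g)" using h g by (intro arc_join) auto
    moreover have "path_image (h +++ g) = drawn (x # y # xs)"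
      using h g by (simp add: path_image_join drawn_def)
    ultimately show ?thesis using h g by (intro exI[of _ "h +++ g"]) auto
  qed
qed auto

text \<open>The nine paths are drawn as arcs that meet only at shared branch points, so they form a
  drawing of K33 itself.\<close>

lemma no_K33_subdivision: "\<not> K33_subdivision (adj G) s t P"
proof
  assume K: "K33_subdivision (adj G) s t P"
  obtain a b c where s: "s = [a, b, c]"
    using K by (auto simp: K33_subdivision_def numeral_3_eq_3 length_Suc_conv)
  obtain x y z where t: "t = [x, y, z]"
    using K by (auto simp: K33_subdivision_def numeral_3_eq_3 length_Suc_conv)
  obtain ax ay az bx by' bz cx cy cz where P: "P = [[ax, ay, az], [bx, by', bz], [cx, cy, cz]]"
    using K by (auto simp: K33_subdivision_def numeral_3_eq_3 length_Suc_conv map_eq_Cons_conv)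
  define L where "L i j = s ! i # P ! i ! j @ [t ! j]" for i j :: nat
  have lt: "i < 3 \<longleftrightarrow> i = 0 \<or> i = 1 \<or> i = 2" for i :: nat by auto
  have dist: "distinct (s @ t @ concat (concat P))" using K by (simp add: K33_subdivision_def)
  have succ: "successively (adj G) (L i j)" if "i < 3" "j < 3" for i j
    using K that unfolding K33_subdivision_def L_def lt by blast
  note D = dist[unfolded s t P, simplified, unfolded Int_Un_distrib, simplified]
  have distL: "distinct (L i j)" if "i < 3" "j < 3" for i j
    using that unfolding lt by (elim disjE) (use D in \<open>simp_all add: L_def s t P\<close>)
  have disjP: "set (P ! i ! j) \<inter> set (P ! k ! l) = {}"
    if "i < 3" "j < 3" "k < 3" "l < 3" "(i, j) \<noteq> (k, l)" for i j k l
    using that unfolding lt by (elim disjE) (simp_all add: P D Int_commute)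
  have s_neq: "s ! i = s ! k \<longleftrightarrow> i = k" if "i < 3" "k < 3" for i k
    using that unfolding lt by (elim disjE) (use D in \<open>auto simp: s\<close>)
  have t_neq: "t ! j = t ! l \<longleftrightarrow> j = l" if "j < 3" "l < 3" for j l
    using that unfolding lt by (elim disjE) (use D in \<open>auto simp: t\<close>)
  have st_neq: "s ! i \<noteq> t ! j" if "i < 3" "j < 3" for i j
    using that unfolding lt by (elim disjE) (use D in \<open>auto simp: s t\<close>)
  have notin: "s ! k \<notin> set (P ! i ! j)" "t ! k \<notin> set (P ! i ! j)" if "i < 3" "j < 3" "k < 3" for i j k
    using that unfolding lt by (elim disjE; use D in \<open>simp add: s t P\<close>)+
  have common: "set (L i j) \<inter> set (L k l) \<subseteq> {v. i = k \<and> v = s ! i \<or> j = l \<and> v = t ! j}"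
    if ij: "i < 3" "j < 3" and kl: "k < 3" "l < 3" and ne: "(i, j) \<noteq> (k, l)" for i j k l
    using disjP[OF ij kl ne] s_neq[OF ij(1) kl(1)] t_neq[OF ij(2) kl(2)] st_neq[OF ij(1) kl(2)]
      st_neq[OF kl(1) ij(2)] notin[OF ij kl(1)] notin[OF ij kl(2)] notin[OF kl ij(1)] notin[OF kl ij(2)]
    unfolding L_def by auto
  have meet: "drawn (L i j) \<inter> drawn (L k l) \<subseteq> {v. i = k \<and> v = p (s ! i) \<or> j = l \<and> v = p (t ! j)}"
    if ij: "i < 3" "j < 3" and kl: "k < 3" "l < 3" and ne: "(i, j) \<noteq> (k, l)" for i j k l
  proof -
    \<comment> \<open>A common edge would give two distinct common vertices, but two different paths
      share at most one branch vertex and nothing else.\<close>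
    have "path_edges (L i j) \<inter> path_edges (L k l) = {}"
    proof (rule ccontr)
      assume "path_edges (L i j) \<inter> path_edges (L k l) \<noteq> {}"
      then obtain e where e: "e \<in> path_edges (L i j)" "e \<in> path_edges (L k l)" by blast
      then obtain u v where "u \<noteq> v" "e = {u, v}" using path_edges_doubleton distL[OF ij] by metis
      then show False
        using common[OF ij kl ne] path_edges_subset[OF e(1)] path_edges_subset[OF e(2)] ne by auto
    qed
    from drawn_Int[OF succ[OF ij] succ[OF kl] this] show ?thesis using common[OF ij kl ne] by blast
  qed
  have "\<exists>g. arc g \<and> pathstart g = p (s ! i) \<and> pathfinish g = p (t ! j) \<and> path_image g = drawn (L i j)"
    if "i < 3" "j < 3" for i j
    using drawn_arc[OF succ[OF that] distL[OF that]] by (simp add: L_def)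
  then obtain g where "\<And>i j. i < 3 \<Longrightarrow> j < 3 \<Longrightarrow> arc (g i j) \<and> pathstart (g i j) = p (s ! i) \<and>
      pathfinish (g i j) = p (t ! j) \<and> path_image (g i j) = drawn (L i j)"
    by metis
  with meet show False by (intro K33_not_planar_arcs[of g "\<lambda>i. p (s ! i)" "\<lambda>j. p (t ! j)"]) auto
qed

end

lemma planar_no_K33_subdivision:
  fixes G :: "'a pair_pre_digraph"
  assumes "planar G"
  shows "\<not> K33_subdivision (adj G) s t P"
  using assms unfolding planar_def
proof (elim exE conjE)
  fix p :: "'a \<Rightarrow> complex" and \<gamma> :: "'a set \<Rightarrow> real \<Rightarrow> complex"
  assume "inj_on p (pverts G)"
    and "\<forall>e\<in>edges G. arc (\<gamma> e) \<and> {pathstart (\<gamma> e), pathfinish (\<gamma> e)} = p ` e \<and>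
      path_image (\<gamma> e) \<inter> p ` pverts G = p ` e"
    and "\<forall>e\<in>edges G. \<forall>f\<in>edges G. e \<noteq> f \<longrightarrow> path_image (\<gamma> e) \<inter> path_image (\<gamma> f) \<subseteq> p ` (e \<inter> f)"
  then have "plane_drawing G p \<gamma>"
    by unfold_locales simp_all
  then show ?thesis by (rule plane_drawing.no_K33_subdivision)
qed

section \<open>Graphs on at most ten vertices\<close>

text \<open>
  Sorting the four neighbours of \<open>v\<close> by the rank breaks the symmetry between them.
\<close>

definition nbr_rank :: "('a \<Rightarrow> 'a \<Rightarrow> bool) \<Rightarrow> 'a \<Rightarrow> 'a \<Rightarrow> 'a \<Rightarrow> 'a \<Rightarrow> nat" where
  "nbr_rank E w\<^sub>1 w\<^sub>2 w\<^sub>3 a =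
     (if E a w\<^sub>2 then 0 else if E a w\<^sub>1 then if E a w\<^sub>3 then 1 else 2 else if E a w\<^sub>3 then 3 else 4)"

lemma nbr_rank_le:
  assumes "nbr_rank E w\<^sub>1 w\<^sub>2 w\<^sub>3 a \<le> nbr_rank E w\<^sub>1 w\<^sub>2 w\<^sub>3 b"
  shows "(E b w\<^sub>2 \<longrightarrow> E a w\<^sub>2) \<and> (E b w\<^sub>1 \<longrightarrow> E a w\<^sub>2 \<or> E a w\<^sub>1) \<and>
    (E b w\<^sub>3 \<longrightarrow> E a w\<^sub>2 \<or> E a w\<^sub>1 \<or> E a w\<^sub>3) \<and> (E b w\<^sub>1 \<and> E b w\<^sub>3 \<longrightarrow> E a w\<^sub>2 \<or> E a w\<^sub>1 \<and> E a w\<^sub>3)"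
  using assms by (auto simp: nbr_rank_def split: if_splits)

text \<open>Vertex 0 has the neighbours 1 to 4, and 5-6-7 is a path of non-neighbours of 0. Nothing
  is fixed about 8 and 9, which may be isolated padding for a smaller graph. With the edges as
  Boolean variables, the statement becomes a finite propositional one.\<close>

lemma no_obstruction_on_10:
  fixes E :: "nat \<Rightarrow> nat \<Rightarrow> bool"
  assumes sym: "\<And>i j. E i j = E j i" and tri: "\<And>i j k. \<not> (E i j \<and> E j k \<and> E i k)"
    and col: "\<And>A. cherry E ({..<10} \<inter> A) \<or> cherry E ({..<10} - A)"
    and K: "\<And>s t P. \<not> K33_subdivision E s t P"
    and star: "E 0 1" "E 0 2" "E 0 3" "E 0 4"
    and path: "E 5 6" "E 6 7" "\<not> E 0 5" "\<not> E 0 6" "\<not> E 0 7"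
    and sorted: "nbr_rank E 5 6 7 1 \<le> nbr_rank E 5 6 7 2" "nbr_rank E 5 6 7 2 \<le> nbr_rank E 5 6 7 3" "nbr_rank E 5 6 7 3 \<le> nbr_rank E 5 6 7 4"
  shows False
proof -
  \<comment> \<open>\<open>Q v i k\<close> serves as an auxiliary propositional variable for a pair
    of edges, so that each colouring becomes a single clause.\<close>
  define Q where "Q v i k \<longleftrightarrow> E v i \<and> E v k" for v i k
  have cherryD: "\<exists>v\<in>S. \<exists>i\<in>S. \<exists>k\<in>S. i < k \<and> Q v i k" if "cherry E S" for S
    using that unfolding cherry_def Q_def by (metis linorder_neqE_nat)
  have U: "[0..<10] = [0::nat,1,2,3,4,5,6,7,8,9]" by (simp add: upt_rec)
  \<comment> \<open>Both colour classes are given as explicit lists, which lets the simplifier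
    expand the quantifiers.\<close>
  have col': "(\<exists>v\<in>set xs. \<exists>i\<in>set xs. \<exists>k\<in>set xs. i < k \<and> Q v i k) \<or>
      (let ys = filter (\<lambda>v. v \<notin> set xs) [0,1,2,3,4,5,6,7,8,9] in
        \<exists>v\<in>set ys. \<exists>i\<in>set ys. \<exists>k\<in>set ys. i < k \<and> Q v i k)" for xs
  proof -
    have "{..<10} - set xs = set (filter (\<lambda>v. v \<notin> set xs) [0..<10])" by auto
    moreover have "cherry E ({..<10} \<inter> set xs) \<Longrightarrow> cherry E (set xs)"
      unfolding cherry_def by blast
    ultimately show ?thesis
      using col[of "set xs"] cherryD unfolding Let_def U by metis
  qed
  \<comment> \<open>The colouring clauses contain \<open>Q\<close> only positively, so the
    implications from \<open>Q\<close> to its two edges are enough to link them to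
    \<open>E\<close>.\<close>
  have Q: "\<forall>v\<in>set [0..<10]. \<forall>i\<in>set [0..<10]. \<forall>k\<in>set [0..<10]. i < k \<longrightarrow>
      (Q v i k \<longrightarrow> E v i) \<and> (Q v i k \<longrightarrow> E v k)"
    by (auto simp: Q_def)
  have T: "\<forall>v\<in>set [0..<10]. \<forall>i\<in>set [0..<10]. \<forall>k\<in>set [0..<10]. v < i \<longrightarrow> i < k \<longrightarrow>
      \<not> (E v i \<and> E i k \<and> E v k)"
    using tri by auto
  \<comment> \<open>Both lists were found by a refinement loop around a SAT solver: as long as the clauses had a
    model, it was either coloured or searched for a subdivision of \<open>K\<^sub>3\<^sub>,\<^sub>3\<close>.\<close>
  note colourings =
    col'[of "[0, 1, 5, 7]"] col'[of "[0, 1, 5, 7, 8]"] col'[of "[0, 1, 6, 7, 8]"]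
    col'[of "[0, 1, 6, 8]"] col'[of "[0, 2, 5, 7]"] col'[of "[0, 2, 5, 7, 8]"]
    col'[of "[0, 2, 6, 7, 8]"] col'[of "[0, 2, 6, 8]"] col'[of "[0, 3, 5, 6, 8]"]
    col'[of "[0, 3, 5, 7, 8]"] col'[of "[0, 3, 6]"] col'[of "[0, 3, 6, 7]"]
    col'[of "[0, 3, 6, 7, 8]"] col'[of "[0, 3, 6, 8]"] col'[of "[0, 4, 5, 6, 8]"]
    col'[of "[0, 4, 5, 7]"] col'[of "[0, 4, 5, 7, 8]"] col'[of "[0, 4, 6]"] col'[of "[0, 4, 6, 8]"]
    col'[of "[0, 5, 6]"] col'[of "[0, 5, 6, 8]"] col'[of "[0, 5, 7]"] col'[of "[0, 5, 7, 8]"]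
    col'[of "[0, 6, 7]"] col'[of "[0, 6, 7, 8]"] col'[of "[0, 6, 8]"] col'[of "[1, 2, 3, 4, 5]"]
    col'[of "[1, 2, 3, 4, 5, 6]"] col'[of "[1, 2, 3, 4, 5, 7]"] col'[of "[1, 2, 3, 4, 5, 7, 8]"]
    col'[of "[1, 2, 3, 4, 5, 8]"] col'[of "[1, 2, 3, 4, 6]"] col'[of "[1, 2, 3, 4, 6, 7]"]
    col'[of "[1, 2, 3, 4, 6, 8]"] col'[of "[1, 2, 3, 4, 7]"] col'[of "[1, 2, 3, 4, 7, 8]"]
    col'[of "[1, 2, 3, 5, 7]"] col'[of "[1, 2, 3, 5, 7, 8]"] col'[of "[1, 2, 3, 6, 8]"]
    col'[of "[1, 2, 3, 7, 8]"] col'[of "[1, 2, 4, 5, 7]"] col'[of "[1, 2, 4, 5, 7, 8]"]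
    col'[of "[1, 2, 4, 6, 8]"] col'[of "[1, 2, 4, 7]"] col'[of "[1, 2, 4, 7, 8]"]
    col'[of "[1, 3, 4, 5, 7]"] col'[of "[1, 3, 4, 5, 7, 8]"] col'[of "[1, 3, 4, 5, 8]"]
    col'[of "[1, 3, 4, 6]"] col'[of "[1, 3, 4, 6, 8]"] col'[of "[2, 3, 4, 5, 7]"]
    col'[of "[2, 3, 4, 5, 7, 8]"] col'[of "[2, 3, 4, 5, 8]"] col'[of "[2, 3, 4, 6]"]
    col'[of "[2, 3, 4, 6, 8]"]
  note subdivisions =
    K[of "[0, 5, 7]" "[1, 2, 8]" "[[[],[],[3]],[[],[],[]],[[],[],[]]]"]
    K[of "[0, 5, 7]" "[1, 2, 9]" "[[[],[],[3]],[[],[],[]],[[],[],[]]]"]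
    K[of "[0, 5, 7]" "[1, 8, 9]" "[[[],[2],[]],[[],[],[]],[[],[],[]]]"]
    K[of "[0, 5, 7]" "[1, 8, 9]" "[[[],[],[2]],[[],[],[]],[[],[],[]]]"]
    K[of "[0, 5, 7]" "[2, 3, 6]" "[[[],[],[1]],[[],[],[]],[[],[],[]]]"]
    K[of "[0, 5, 7]" "[3, 4, 6]" "[[[],[],[1]],[[],[],[]],[[],[],[]]]"]
    K[of "[0, 5, 7]" "[3, 6, 8]" "[[[],[1],[]],[[],[],[]],[[],[],[]]]"]
    K[of "[0, 5, 7]" "[3, 6, 9]" "[[[],[1],[]],[[],[],[]],[[],[],[]]]"]
    K[of "[0, 5, 7]" "[4, 6, 8]" "[[[],[1],[]],[[],[],[]],[[],[],[]]]"]
    K[of "[0, 5, 7]" "[4, 6, 9]" "[[[],[1],[]],[[],[],[]],[[],[],[]]]"]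
    K[of "[0, 5, 7]" "[6, 8, 9]" "[[[1],[],[]],[[],[],[]],[[],[],[]]]"]
    K[of "[0, 5, 8]" "[1, 2, 3]" "[[[],[],[]],[[6],[],[]],[[],[],[]]]"]
    K[of "[0, 5, 8]" "[1, 2, 3]" "[[[],[],[]],[[],[],[]],[[7],[],[]]]"]
    K[of "[0, 5, 8]" "[1, 2, 4]" "[[[],[],[]],[[],[],[]],[[7],[],[]]]"]
    K[of "[0, 5, 8]" "[1, 2, 4]" "[[[],[],[]],[[6],[],[]],[[],[],[]]]"]
    K[of "[0, 5, 8]" "[1, 2, 9]" "[[[],[],[3]],[[],[],[]],[[],[],[]]]"]
    K[of "[0, 5, 8]" "[1, 3, 4]" "[[[],[],[]],[[],[],[]],[[7],[],[]]]"]
    K[of "[0, 5, 8]" "[1, 3, 4]" "[[[],[],[]],[[6],[],[]],[[],[],[]]]"]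
    K[of "[0, 5, 8]" "[2, 3, 4]" "[[[],[],[]],[[6],[],[]],[[],[],[]]]"]
    K[of "[0, 5, 8]" "[2, 3, 4]" "[[[],[],[]],[[],[],[]],[[7],[],[]]]"]
    K[of "[0, 5, 8]" "[3, 4, 6]" "[[[],[],[1]],[[],[],[]],[[],[],[]]]"]
    K[of "[0, 5, 8]" "[4, 6, 9]" "[[[],[1],[]],[[],[],[]],[[],[],[]]]"]
    K[of "[0, 5, 9]" "[1, 2, 3]" "[[[],[],[]],[[6],[],[]],[[],[],[]]]"]
    K[of "[0, 5, 9]" "[1, 2, 3]" "[[[],[],[]],[[],[],[]],[[7],[],[]]]"]
    K[of "[0, 5, 9]" "[1, 2, 4]" "[[[],[],[]],[[],[],[]],[[7],[],[]]]"]
    K[of "[0, 5, 9]" "[1, 2, 4]" "[[[],[],[]],[[6],[],[]],[[],[],[]]]"]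
    K[of "[0, 5, 9]" "[1, 2, 8]" "[[[],[],[3]],[[],[],[]],[[],[],[]]]"]
    K[of "[0, 5, 9]" "[1, 3, 4]" "[[[],[],[]],[[],[],[]],[[7],[],[]]]"]
    K[of "[0, 5, 9]" "[1, 3, 4]" "[[[],[],[]],[[6],[],[]],[[],[],[]]]"]
    K[of "[0, 5, 9]" "[2, 3, 4]" "[[[],[],[]],[[],[],[]],[[7],[],[]]]"]
    K[of "[0, 5, 9]" "[2, 3, 4]" "[[[],[],[]],[[6],[],[]],[[],[],[]]]"]
    K[of "[0, 5, 9]" "[3, 4, 6]" "[[[],[],[1]],[[],[],[]],[[],[],[]]]"]
    K[of "[0, 5, 9]" "[4, 6, 8]" "[[[],[1],[]],[[],[],[]],[[],[],[]]]"]
    K[of "[0, 6, 8]" "[1, 2, 3]" "[[[],[],[]],[[],[],[5]],[[],[],[]]]"]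
    K[of "[0, 6, 8]" "[1, 2, 4]" "[[[],[],[]],[[],[],[5]],[[],[],[]]]"]
    K[of "[0, 6, 8]" "[1, 2, 5]" "[[[],[],[3]],[[],[],[]],[[],[],[]]]"]
    K[of "[0, 6, 8]" "[1, 2, 7]" "[[[],[],[3]],[[],[],[]],[[],[],[]]]"]
    K[of "[0, 6, 8]" "[1, 3, 4]" "[[[],[],[]],[[],[],[5]],[[],[],[]]]"]
    K[of "[0, 6, 8]" "[1, 5, 9]" "[[[],[2],[]],[[],[],[]],[[],[],[]]]"]
    K[of "[0, 6, 8]" "[1, 7, 9]" "[[[],[2],[]],[[],[],[]],[[],[],[]]]"]
    K[of "[0, 6, 8]" "[2, 3, 4]" "[[[],[],[]],[[],[],[5]],[[],[],[]]]"]
    K[of "[0, 6, 9]" "[1, 2, 3]" "[[[],[],[]],[[],[],[5]],[[],[],[]]]"]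
    K[of "[0, 6, 9]" "[1, 2, 4]" "[[[],[],[]],[[],[],[7]],[[],[],[]]]"]
    K[of "[0, 6, 9]" "[1, 2, 5]" "[[[],[],[3]],[[],[],[]],[[],[],[]]]"]
    K[of "[0, 6, 9]" "[1, 2, 7]" "[[[],[],[3]],[[],[],[]],[[],[],[]]]"]
    K[of "[0, 6, 9]" "[1, 3, 4]" "[[[],[],[]],[[],[],[5]],[[],[],[]]]"]
    K[of "[0, 6, 9]" "[1, 5, 8]" "[[[],[2],[]],[[],[],[]],[[],[],[]]]"]
    K[of "[0, 6, 9]" "[1, 7, 8]" "[[[],[2],[]],[[],[],[]],[[],[],[]]]"]
    K[of "[0, 6, 9]" "[2, 3, 4]" "[[[],[],[]],[[],[],[5]],[[],[],[]]]"]
    K[of "[0, 7, 8]" "[1, 2, 3]" "[[[],[],[]],[[6],[],[]],[[],[],[]]]"]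
    K[of "[0, 7, 8]" "[1, 2, 3]" "[[[],[],[]],[[],[],[]],[[5],[],[]]]"]
    K[of "[0, 7, 8]" "[1, 2, 4]" "[[[],[],[]],[[],[],[]],[[5],[],[]]]"]
    K[of "[0, 7, 8]" "[1, 2, 4]" "[[[],[],[]],[[6],[],[]],[[],[],[]]]"]
    K[of "[0, 7, 8]" "[1, 3, 4]" "[[[],[],[]],[[],[],[]],[[5],[],[]]]"]
    K[of "[0, 7, 8]" "[1, 3, 4]" "[[[],[],[]],[[6],[],[]],[[],[],[]]]"]
    K[of "[0, 7, 8]" "[2, 3, 4]" "[[[],[],[]],[[6],[],[]],[[],[],[]]]"]
    K[of "[0, 7, 8]" "[2, 3, 4]" "[[[],[],[]],[[],[],[]],[[5],[],[]]]"]
    K[of "[0, 7, 8]" "[3, 4, 6]" "[[[],[],[1]],[[],[],[]],[[],[],[]]]"]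
    K[of "[0, 7, 8]" "[3, 4, 9]" "[[[],[],[1]],[[],[],[]],[[],[],[]]]"]
    K[of "[0, 7, 8]" "[4, 6, 9]" "[[[],[1],[]],[[],[],[]],[[],[],[]]]"]
    K[of "[0, 7, 9]" "[1, 2, 3]" "[[[],[],[]],[[6],[],[]],[[],[],[]]]"]
    K[of "[0, 7, 9]" "[1, 2, 3]" "[[[],[],[]],[[],[],[]],[[5],[],[]]]"]
    K[of "[0, 7, 9]" "[1, 2, 4]" "[[[],[],[]],[[],[],[]],[[5],[],[]]]"]
    K[of "[0, 7, 9]" "[1, 2, 4]" "[[[],[],[]],[[6],[],[]],[[],[],[]]]"]
    K[of "[0, 7, 9]" "[1, 3, 4]" "[[[],[],[]],[[],[],[]],[[5],[],[]]]"]
    K[of "[0, 7, 9]" "[1, 3, 4]" "[[[],[],[]],[[6],[],[]],[[],[],[]]]"]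
    K[of "[0, 7, 9]" "[2, 3, 4]" "[[[],[],[]],[[],[],[]],[[5],[],[]]]"]
    K[of "[0, 7, 9]" "[2, 3, 4]" "[[[],[],[]],[[6],[],[]],[[],[],[]]]"]
    K[of "[0, 7, 9]" "[3, 4, 6]" "[[[],[],[1]],[[],[],[]],[[],[],[]]]"]
    K[of "[0, 7, 9]" "[3, 4, 8]" "[[[],[],[1]],[[],[],[]],[[],[],[]]]"]
    K[of "[0, 7, 9]" "[4, 6, 8]" "[[[],[1],[]],[[],[],[]],[[],[],[]]]"]
    K[of "[0, 8, 9]" "[1, 2, 3]" "[[[],[],[]],[[],[],[]],[[5],[],[]]]"]
    K[of "[0, 8, 9]" "[1, 2, 3]" "[[[],[],[]],[[5],[],[]],[[],[],[]]]"]
    K[of "[0, 8, 9]" "[1, 2, 4]" "[[[],[],[]],[[],[],[]],[[5],[],[]]]"]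
    K[of "[0, 8, 9]" "[1, 2, 4]" "[[[],[],[]],[[5],[],[]],[[],[],[]]]"]
    K[of "[0, 8, 9]" "[1, 3, 4]" "[[[],[],[]],[[5],[],[]],[[],[],[]]]"]
    K[of "[0, 8, 9]" "[1, 3, 4]" "[[[],[],[]],[[],[],[]],[[5],[],[]]]"]
    K[of "[0, 8, 9]" "[2, 3, 4]" "[[[],[],[]],[[5],[],[]],[[],[],[]]]"]
    K[of "[0, 8, 9]" "[2, 3, 4]" "[[[],[],[]],[[],[],[]],[[5],[],[]]]"]
    K[of "[0, 8, 9]" "[3, 4, 5]" "[[[],[],[1]],[[],[],[]],[[],[],[]]]"]
    K[of "[0, 8, 9]" "[3, 4, 7]" "[[[],[],[1]],[[],[],[]],[[],[],[]]]"]
    K[of "[1, 5, 7]" "[2, 6, 8]" "[[[0],[],[]],[[],[],[]],[[],[],[]]]"]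
    K[of "[1, 5, 7]" "[2, 6, 9]" "[[[0],[],[]],[[],[],[]],[[],[],[]]]"]
    K[of "[1, 5, 7]" "[3, 6, 8]" "[[[0],[],[]],[[],[],[]],[[],[],[]]]"]
    K[of "[1, 5, 7]" "[3, 6, 9]" "[[[0],[],[]],[[],[],[]],[[],[],[]]]"]
    K[of "[2, 5, 7]" "[3, 6, 8]" "[[[0],[],[]],[[],[],[]],[[],[],[]]]"]
    K[of "[2, 5, 7]" "[3, 6, 9]" "[[[0],[],[]],[[],[],[]],[[],[],[]]]"]
  have irrefl: "\<not> E i i" for i using tri[of i i i] by blast
  \<comment> \<open>Used as an ordered rewrite rule, symmetry leaves one propositional atom for each
    undirected edge.\<close>
  note sym[simp] irrefl[simp]
  note clauses = colourings[unfolded Let_def, simplified] subdivisions[unfolded K33_subdivision_def, simplified]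
    Q[unfolded U, simplified] T[unfolded U, simplified]
    sorted[THEN nbr_rank_le, simplified] star[simplified] path[simplified]
  show False using clauses by sat
qed

section \<open>Maximum cuts and the reduction to ten indices\<close>

lemma card_ge_2I:
  assumes "finite S" "i \<in> S" "k \<in> S" "i \<noteq> k"
  shows "2 \<le> card S"
  using card_mono[of S "{i, k}"] assms by auto

text \<open>A set \<open>A\<close> with the fewest arcs inside the two sides is a maximum cut. If
  \<open>v\<close> had two neighbours on its own side, it would have at most one across, and moving
  it would lower the count.\<close>

lemma max_cut:
  assumes fin: "finite V" and wf: "\<And>u v. E u v \<Longrightarrow> u \<in> V \<and> v \<in> V"
    and sym: "\<And>u v. E u v \<longleftrightarrow> E v u" and irrefl: "\<And>u. \<not> E u u"
    and deg: "\<And>v. v \<in> V \<Longrightarrow> card {u. E v u} \<le> 3"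
  shows "\<exists>A\<subseteq>V. \<not> cherry E A \<and> \<not> cherry E (V - A)"
proof -
  define mono_arcs where "mono_arcs A = {(u, w). E u w \<and> (u \<in> A \<longleftrightarrow> w \<in> A)}" for A
  define same where "same A v = {x. E v x \<and> (x \<in> A \<longleftrightarrow> v \<in> A)}" for A v
  define rest where "rest A v = {(u, w) \<in> mono_arcs A. u \<noteq> v \<and> w \<noteq> v}" for A v
  have finE: "finite {u. E v u}" for v by (rule finite_subset[OF _ fin]) (use wf in auto)
  have fin_mono_arcs: "finite (mono_arcs A)" for A
    by (rule finite_subset[of _ "V \<times> V"]) (use wf fin in \<open>auto simp: mono_arcs_def\<close>)
  \<comment> \<open>Each neighbour of \<open>v\<close> on its own side accounts for two arcs at
    \<open>v\<close>, one in each direction; the arcs avoiding \<open>v\<close> form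
    \<open>rest\<close>.\<close>
  have card_mono_eq: "card (mono_arcs A) = card (rest A v) + 2 * card (same A v)" for A v
  proof -
    have fs: "finite (same A v)" by (rule finite_subset[OF _ finE[of v]]) (auto simp: same_def)
    have "mono_arcs A = rest A v \<union> (Pair v ` same A v \<union> (\<lambda>x. (x, v)) ` same A v)"
      using sym by (auto simp: mono_arcs_def rest_def same_def)
    moreover have "card \<dots> = card (rest A v) + card (Pair v ` same A v \<union> (\<lambda>x. (x, v)) ` same A v)"
      using fs fin_mono_arcs[of A] by (intro card_Un_disjoint) (auto simp: rest_def intro: finite_subset[of _ "mono_arcs A"])
    moreover have "card (Pair v ` same A v \<union> (\<lambda>x. (x, v)) ` same A v) = card (same A v) + card (same A v)"
      using fs irrefl by (subst card_Un_disjoint) (auto simp: same_def card_image inj_on_def)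
    ultimately show ?thesis by simp
  qed
  obtain A where A: "A \<subseteq> V" "\<And>B. B \<subseteq> V \<Longrightarrow> card (mono_arcs A) \<le> card (mono_arcs B)"
    using ex_has_least_nat[of "\<lambda>A. A \<subseteq> V" V "\<lambda>A. card (mono_arcs A)"] by auto
  have same_le: "card (same A v) < 2" if v: "v \<in> V" for v
  proof (rule ccontr)
    assume two: "\<not> card (same A v) < 2"
    define B where "B = (if v \<in> A then A - {v} else insert v A)"
    have "B \<subseteq> V" using A(1) v by (auto simp: B_def)
    \<comment> \<open>Moving \<open>v\<close> leaves the arcs avoiding \<open>v\<close> as they are
      and exchanges its neighbours on its own side with those across.\<close>
    have "rest B v = rest A v" by (auto simp: rest_def mono_arcs_def B_def)
    moreover have "same A v \<union> same B v = {u. E v u}" "same A v \<inter> same B v = {}"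
      using irrefl by (auto simp: same_def B_def)
    then have "card (same A v) + card (same B v) \<le> 3"
      using deg[OF v] finE[of v] by (metis card_Un_disjoint finite_Un)
    ultimately have "card (mono_arcs B) < card (mono_arcs A)"
      using two card_mono_eq[of A v] card_mono_eq[of B v] by simp
    then show False using A(2)[OF \<open>B \<subseteq> V\<close>] by linarith
  qed
  have "\<not> cherry E S" if "S = A \<or> S = V - A" for S
  proof
    assume "cherry E S"
    then obtain v i k where "v \<in> S" "i \<in> S" "k \<in> S" "i \<noteq> k" "E v i" "E v k" by (auto simp: cherry_def)
    moreover from this that A(1) have "v \<in> V" "i \<in> same A v" "k \<in> same A v" by (auto simp: same_def)
    moreover have "finite (same A v)" by (rule finite_subset[OF _ finE[of v]]) (auto simp: same_def)
    ultimately show False using same_le[of v] card_ge_2I[of "same A v" i k] by simp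
  qed
  then show ?thesis using A(1) by blast
qed

text \<open>Listing the vertices with the eight special ones first turns a counterexample into a
  relation on the indices below 10 that \<open>no_obstruction_on_10\<close> refutes.\<close>

lemma two_colourable_upto_10:
  assumes fin: "finite V" and card: "card V \<le> 10" and wf: "\<And>u v. E u v \<Longrightarrow> u \<in> V \<and> v \<in> V"
    and sym: "\<And>u v. E u v \<longleftrightarrow> E v u" and irrefl: "\<And>u. \<not> E u u"
    and tri: "\<And>u v w. \<not> (E u v \<and> E v w \<and> E u w)"
    and K: "\<And>s t P. \<not> K33_subdivision E s t P"
  shows "\<exists>A\<subseteq>V. \<not> cherry E A \<and> \<not> cherry E (V - A)"
proof (rule ccontr)
  assume "\<not> ?thesis"
  then have nc: "cherry E A \<or> cherry E (V - A)" if "A \<subseteq> V" for A using that by blast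
  have "\<exists>v\<in>V. \<not> card {u. E v u} \<le> 3"
  proof (rule ccontr)
    assume "\<not> ?thesis"
    then have "\<And>v. v \<in> V \<Longrightarrow> card {u. E v u} \<le> 3" by blast
    from max_cut[OF fin wf sym irrefl this] show False using nc by blast
  qed
  then obtain v where v: "v \<in> V" "4 \<le> card {u. E v u}" by force
  define N where "N = {u. E v u}"
  have "N \<subseteq> V" using wf by (auto simp: N_def)
  \<comment> \<open>Two adjacent neighbours of \<open>v\<close> would complete a triangle, so the
    colouring with classes \<open>N\<close> and \<open>V - N\<close> can fail only on
    \<open>V - N\<close>.\<close>
  have "\<not> cherry E N" using tri by (auto simp: cherry_def N_def)
  then have "cherry E (V - N)" using nc[OF \<open>N \<subseteq> V\<close>] by blast
  then obtain w1 w2 w3 where w: "w1 \<in> V - N" "w2 \<in> V - N" "w3 \<in> V - N" "w1 \<noteq> w3" "E w2 w1" "E w2 w3"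
    unfolding cherry_def by blast
  obtain T where T: "T \<subseteq> N" "card T = 4" using v(2) obtain_subset_with_card_n N_def by metis
  have "finite T" using T(2) card.infinite by fastforce
  then obtain ts where ts: "set ts = T" "distinct ts" using finite_distinct_list by blast
  define as where "as = sort_key (nbr_rank E w1 w2 w3) ts"
  have as: "set as = T" "distinct as" "sorted (map (nbr_rank E w1 w2 w3) as)"
    using ts by (auto simp: as_def)
  have "length as = 4" using as T(2) distinct_card by metis
  then obtain a1 a2 a3 a4 where as_eq: "as = [a1, a2, a3, a4]"
    by (auto simp: length_Suc_conv eval_nat_numeral)
  obtain rs where rs: "set rs = V - set (v # as @ [w1, w2, w3])" "distinct rs"
    using finite_distinct_list[OF finite_Diff[OF fin]] by blast
  define xs where "xs = v # as @ [w1, w2, w3] @ rs"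
  have aN: "a1 \<in> N" "a2 \<in> N" "a3 \<in> N" "a4 \<in> N" using as(1) T(1) as_eq by auto
  have vN: "v \<notin> N" using irrefl by (simp add: N_def)
  \<comment> \<open>All neighbours of \<open>v\<close> lie in \<open>N\<close>, so \<open>v\<close>
    is on no edge within \<open>V - N\<close>.\<close>
  have vw: "v \<noteq> w1" "v \<noteq> w2" "v \<noteq> w3" using w sym by (auto simp: N_def)
  have dist: "distinct xs"
    using as(2) rs vN vw aN w irrefl unfolding xs_def as_eq by auto
  have set_xs: "set xs = V"
    using rs(1) aN w v(1) \<open>N \<subseteq> V\<close> unfolding xs_def as_eq by auto
  define n where "n = length xs"
  have "n \<le> 10" using card set_xs dist distinct_card n_def by metis
  have "8 \<le> n" by (simp add: n_def xs_def as_eq)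
  \<comment> \<open>Indices from \<open>n\<close> on are isolated in \<open>F\<close>, which pads a
    graph with fewer than ten vertices.\<close>
  define F where "F i j \<longleftrightarrow> i < n \<and> j < n \<and> E (xs ! i) (xs ! j)" for i j
  have nth: "xs ! 0 = v" "xs ! 1 = a1" "xs ! 2 = a2" "xs ! 3 = a3" "xs ! 4 = a4"
    "xs ! 5 = w1" "xs ! 6 = w2" "xs ! 7 = w3"
    by (simp_all add: xs_def as_eq)
  have rankF: "nbr_rank F 5 6 7 i = nbr_rank E w1 w2 w3 (xs ! i)" if "i < 8" for i
    using that \<open>8 \<le> n\<close> nth by (simp add: nbr_rank_def F_def)
  have inj: "inj_on (\<lambda>i. xs ! i) {..<n}" using dist by (simp add: n_def inj_on_nth)
  have lift: "cherry F S" if S: "cherry E ((\<lambda>i. xs ! i) ` S)" "S \<subseteq> {..<n}" for S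
  proof -
    obtain v i k where *: "v \<in> S" "i \<in> S" "k \<in> S" "xs ! i \<noteq> xs ! k" "E (xs ! v) (xs ! i)" "E (xs ! v) (xs ! k)"
      using S(1) unfolding cherry_def by blast
    then have "F v i" "F v k" "i \<noteq> k" using S(2) unfolding F_def by auto
    with *(1-3) show ?thesis unfolding cherry_def by blast
  qed
  show False
  proof (rule no_obstruction_on_10[of F])
    show "F i j = F j i" for i j using sym by (auto simp: F_def)
    show "\<not> (F i j \<and> F j k \<and> F i k)" for i j k using tri by (auto simp: F_def)
    show "\<not> K33_subdivision F s t P" for s t P
      using K33_subdivision_map[of F s t P "{..<n}" E "\<lambda>i. xs ! i"] K inj by (auto simp: F_def)
    show "cherry F ({..<10} \<inter> A) \<or> cherry F ({..<10} - A)" for A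
    proof -
      let ?A = "{..<n} \<inter> A" and ?B = "{..<n} - A"
      have "V = (\<lambda>i. xs ! i) ` {..<n}" using set_xs by (auto simp: n_def set_conv_nth)
      moreover have "(\<lambda>i. xs ! i) ` {..<n} - (\<lambda>i. xs ! i) ` ?A = (\<lambda>i. xs ! i) ` ?B"
        using inj by (auto simp: inj_on_def)
      ultimately have "cherry E ((\<lambda>i. xs ! i) ` ?A) \<or> cherry E ((\<lambda>i. xs ! i) ` ?B)"
        using nc[of "(\<lambda>i. xs ! i) ` ?A"] by auto
      then have "cherry F ?A \<or> cherry F ?B" using lift[of ?A] lift[of ?B] by auto
      \<comment> \<open>A cherry persists when its class is enlarged by the padding indices.\<close>
      moreover have "?A \<subseteq> {..<10} \<inter> A" "?B \<subseteq> {..<10} - A" using \<open>n \<le> 10\<close> by auto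
      ultimately show ?thesis unfolding cherry_def by blast
    qed
    show "F 0 1" "F 0 2" "F 0 3" "F 0 4" "F 5 6" "F 6 7"
      using aN w sym \<open>8 \<le> n\<close> by (simp_all add: F_def nth[unfolded One_nat_def] N_def)
    show "\<not> F 0 5" "\<not> F 0 6" "\<not> F 0 7" using w nth by (simp_all add: F_def N_def)
    show "nbr_rank F 5 6 7 1 \<le> nbr_rank F 5 6 7 2" "nbr_rank F 5 6 7 2 \<le> nbr_rank F 5 6 7 3" "nbr_rank F 5 6 7 3 \<le> nbr_rank F 5 6 7 4"
      using as(3) rankF[of 1] rankF[of 2] rankF[of 3] rankF[of 4] nth by (simp_all add: as_eq)
  qed
qed

section \<open>Straight-line drawings\<close>

text \<open>Twice the signed area of the triangle \<open>a b c\<close>; its sign tells on which side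
  of the line through \<open>a\<close> and \<open>b\<close> the point \<open>c\<close> lies.\<close>

definition cross :: "complex \<Rightarrow> complex \<Rightarrow> complex \<Rightarrow> real" where
  "cross a b c = (Re b - Re a) * (Im c - Im a) - (Im b - Im a) * (Re c - Re a)"

lemma cross_convex: "cross a b ((1 - t) *\<^sub>R c + t *\<^sub>R d) = (1 - t) * cross a b c + t * cross a b d"
  by (simp add: cross_def algebra_simps)

lemma cross_closed_segment: "z \<in> closed_segment a b \<Longrightarrow> cross a b z = 0"
  by (auto simp: closed_segment_def cross_convex) (simp add: cross_def algebra_simps)

text \<open>If \<open>c\<close> and \<open>d\<close> lie strictly on one side of the line through
  \<open>a\<close> and \<open>b\<close>, so does the segment between them, as \<open>cross\<close>
  is affine in its third argument.\<close>

lemma closed_segments_disjoint: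
  assumes "cross a b c * cross a b d > 0"
  shows "closed_segment a b \<inter> closed_segment c d = {}"
proof -
  have "cross a b z \<noteq> 0" if "z \<in> closed_segment c d" for z
  proof -
    obtain t where t: "0 \<le> t" "t \<le> 1" "z = (1 - t) *\<^sub>R c + t *\<^sub>R d"
      using \<open>z \<in> _\<close> by (auto simp: closed_segment_def)
    show ?thesis
    proof (cases "cross a b c > 0")
      case True
      with assms have "cross a b d > 0" by (simp add: zero_less_mult_iff)
      then show ?thesis using True t convex_bound_lt[of "- cross a b c" 0 "- cross a b d" "1 - t" t]
        by (simp add: cross_convex)
    next
      case False
      with assms have "cross a b c < 0" "cross a b d < 0" by (auto simp: zero_less_mult_iff)
      then show ?thesis using t convex_bound_lt[of "cross a b c" 0 "cross a b d" "1 - t" t]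
        by (simp add: cross_convex)
    qed
  qed
  then show ?thesis using cross_closed_segment by blast
qed

text \<open>Along the segment from \<open>a\<close> to \<open>c\<close>, the value of
  \<open>cross a b\<close> is \<open>t * cross a b c\<close>, which vanishes only at
  \<open>a\<close>.\<close>

lemma closed_segments_common_end:
  assumes "cross a b c \<noteq> 0"
  shows "closed_segment a b \<inter> closed_segment a c \<subseteq> {a}"
proof
  fix z assume z: "z \<in> closed_segment a b \<inter> closed_segment a c"
  then obtain t where t: "z = (1 - t) *\<^sub>R a + t *\<^sub>R c" by (auto simp: closed_segment_def)
  then have "t * cross a b c = 0"
    using z cross_closed_segment[of z a b] by (simp add: cross_convex) (simp add: cross_def)
  then show "z \<in> {a}" using assms t by simp
qed

text \<open>A sign test sufficient for two edges to be drawn correctly: either one segment lies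
  strictly on one side of the line carrying the other, or the two share an end and are not
  collinear.\<close>

definition segs_ok :: "complex \<Rightarrow> complex \<Rightarrow> complex \<Rightarrow> complex \<Rightarrow> bool" where
  "segs_ok a b c d \<longleftrightarrow> cross a b c * cross a b d > 0 \<or> cross c d a * cross c d b > 0 \<or>
     a = c \<and> cross a b d \<noteq> 0 \<or> a = d \<and> cross a b c \<noteq> 0 \<or> b = c \<and> cross b a d \<noteq> 0 \<or> b = d \<and> cross b a c \<noteq> 0"

lemma segs_ok:
  assumes "segs_ok a b c d"
  shows "closed_segment a b \<inter> closed_segment c d \<subseteq> {a, b} \<inter> {c, d}"
  using assms unfolding segs_ok_def
proof (elim disjE conjE)
  assume "cross c d a * cross c d b > 0"
  from closed_segments_disjoint[OF this] show ?thesis by blast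
qed (use closed_segments_disjoint[of a b c d] closed_segments_common_end[of a b d]
       closed_segments_common_end[of a b c] closed_segments_common_end[of b a d]
       closed_segments_common_end[of b a c] in \<open>auto simp: closed_segment_commute\<close>)

text \<open>Only pairs of edges have to be checked: a vertex lying on a foreign edge is itself an
  end of another edge, and those two edges would meet wrongly.\<close>

lemma planar_straight_line:
  fixes G :: "'a :: linorder pair_pre_digraph" and p :: "'a \<Rightarrow> complex"
  assumes G: "pair_graph G" and inj: "inj_on p (pverts G)"
    and no_isolated: "\<And>v. v \<in> pverts G \<Longrightarrow> \<exists>w. adj G v w"
    and ok: "\<And>a b c d. adj G a b \<Longrightarrow> adj G c d \<Longrightarrow> a < b \<Longrightarrow> c < d \<Longrightarrow> (a, b) \<noteq> (c, d) \<Longrightarrow>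
      segs_ok (p a) (p b) (p c) (p d)"
  shows "planar G"
proof -
  note sym = pair_graph_sym[OF G] and irrefl = pair_graph_irrefl[OF G] and wf = pair_graph_wf[OF G]
    and edges_iff = pair_graph_edges[OF G]
  \<comment> \<open>An edge is an unordered set, so the order on the vertices fixes the direction of
    its segment.\<close>
  define \<gamma> where "\<gamma> e = linepath (p (Min e)) (p (Max e))" for e
  have edge: "\<exists>a b. e = {a, b} \<and> a < b \<and> adj G a b \<and> \<gamma> e = linepath (p a) (p b)" if e: "e \<in> edges G" for e
  proof -
    obtain u v where uv: "e = {u, v}" "adj G u v" using e by (auto simp: edges_def)
    have "adj G v u" "u \<noteq> v" using uv(2) sym irrefl by blast+
    then obtain a b where "e = {a, b}" "a < b" "adj G a b"
      using uv by (metis insert_commute linorder_less_linear)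
    then show ?thesis by (auto simp: \<gamma>_def)
  qed
  have meet: "path_image (\<gamma> e) \<inter> path_image (\<gamma> f) \<subseteq> p ` (e \<inter> f)" if ef: "e \<in> edges G" "f \<in> edges G" "e \<noteq> f" for e f
  proof -
    obtain a b where ab: "e = {a, b}" "a < b" "adj G a b" "\<gamma> e = linepath (p a) (p b)" using edge ef by blast
    obtain c d where cd: "f = {c, d}" "c < d" "adj G c d" "\<gamma> f = linepath (p c) (p d)" using edge ef by blast
    have "path_image (\<gamma> e) \<inter> path_image (\<gamma> f) \<subseteq> p ` e \<inter> p ` f"
      using segs_ok[OF ok[OF ab(3) cd(3) ab(2) cd(2)]] ab cd ef(3) by auto
    also have "\<dots> = p ` (e \<inter> f)"
      using ab(1,3) cd(1,3) wf by (intro inj_on_image_Int[OF inj, symmetric]) auto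
    finally show ?thesis .
  qed
  have ends: "p ` e \<subseteq> path_image (\<gamma> e)" if "e \<in> edges G" for e using edge[OF that] by auto
  have "arc (\<gamma> e) \<and> {pathstart (\<gamma> e), pathfinish (\<gamma> e)} = p ` e \<and> path_image (\<gamma> e) \<inter> p ` pverts G = p ` e"
    if e: "e \<in> edges G" for e
  proof -
    obtain a b where ab: "e = {a, b}" "a < b" "adj G a b" "\<gamma> e = linepath (p a) (p b)" using edge e by blast
    have V: "a \<in> pverts G" "b \<in> pverts G" using ab(3) wf by blast+
    then have "p a \<noteq> p b" using inj ab(2) by (auto dest: inj_onD)
    moreover have "p v \<in> p ` e" if v: "v \<in> pverts G" "p v \<in> path_image (\<gamma> e)" for v
    proof (rule ccontr)
      assume notin: "p v \<notin> p ` e"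
      obtain w where w: "adj G v w" using no_isolated v(1) by blast
      then have f: "{v, w} \<in> edges G" "{v, w} \<noteq> e" using edges_iff notin by auto
      then have "p v \<in> p ` (e \<inter> {v, w})" using meet[OF e f(1)] ends[OF f(1)] v(2) by auto
      then show False using notin by auto
    qed
    ultimately show ?thesis using ab V ends[OF e] by auto
  qed
  then show ?thesis unfolding planar_def using inj meet by blast
qed

section \<open>The extremal graph\<close>

text \<open>Vertices 4, 5, 6 join 0 to 1, vertices 7, 8 join 0 to 2, and vertices 9, 10 join 1 to 3;
  the last three edges form the path 0-3-2-1. Each edge is listed once, smaller end first.\<close>

definition extremal_edges :: "(nat \<times> nat) list" where
  "extremal_edges = [(0,4),(0,5),(0,6),(1,4),(1,5),(1,6),(0,7),(0,8),(2,7),(2,8),(1,9),(1,10),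
     (3,9),(3,10),(2,3),(1,2),(0,3)]"

definition extremal_graph :: "nat pair_pre_digraph" where
  "extremal_graph = \<lparr>pverts = {..<11}, parcs = set extremal_edges \<union> (set extremal_edges)\<inverse>\<rparr>"

text \<open>Integer coordinates allow every orientation test to be evaluated exactly.\<close>

definition extremal_points :: "(int \<times> int) list" where
  "extremal_points = [(0,3),(4,0),(2,3),(3,4),(1,2),(0,1),(1,1),(2,2),(3,1),(3,3),(4,2)]"

definition cross_int :: "int \<times> int \<Rightarrow> int \<times> int \<Rightarrow> int \<times> int \<Rightarrow> int" where
  "cross_int a b c = (fst b - fst a) * (snd c - snd a) - (snd b - snd a) * (fst c - fst a)"

definition extremal_position :: "nat \<Rightarrow> complex" where
  "extremal_position v = (case extremal_points ! v of (x, y) \<Rightarrow> Complex (of_int x) (of_int y))"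

lemma pair_graph_extremal: "pair_graph extremal_graph"
proof
  show "symmetric (with_proj extremal_graph)"
    by (auto simp: extremal_graph_def symmetric_def sym_def)
qed (auto simp: extremal_graph_def extremal_edges_def)

lemma triangle_free_extremal: "triangle_free extremal_graph"
proof -
  have arcs: "parcs extremal_graph = set (extremal_edges @ map prod.swap extremal_edges)"
    by (auto simp: extremal_graph_def)
  have "\<forall>(u, v)\<in>set (extremal_edges @ map prod.swap extremal_edges).
      \<forall>(v', w)\<in>set (extremal_edges @ map prod.swap extremal_edges).
        v' = v \<longrightarrow> (u, w) \<notin> set (extremal_edges @ map prod.swap extremal_edges)"
    by code_simp
  then show ?thesis
    unfolding triangle_free_iff[OF pair_graph_extremal] arcs by blast
qed

lemma cross_extremal:
  "cross (extremal_position a) (extremal_position b) (extremal_position c) =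
     of_int (cross_int (extremal_points ! a) (extremal_points ! b) (extremal_points ! c))"
  by (simp add: cross_def cross_int_def extremal_position_def split: prod.splits)

definition segs_ok_int :: "int \<times> int \<Rightarrow> int \<times> int \<Rightarrow> int \<times> int \<Rightarrow> int \<times> int \<Rightarrow> bool" where
  "segs_ok_int a b c d \<longleftrightarrow> cross_int a b c * cross_int a b d > 0 \<or> cross_int c d a * cross_int c d b > 0 \<or>
     a = c \<and> cross_int a b d \<noteq> 0 \<or> a = d \<and> cross_int a b c \<noteq> 0 \<or>
     b = c \<and> cross_int b a d \<noteq> 0 \<or> b = d \<and> cross_int b a c \<noteq> 0"

lemma segs_ok_extremal:
  assumes "segs_ok_int (extremal_points ! a) (extremal_points ! b) (extremal_points ! c) (extremal_points ! d)"
  shows "segs_ok (extremal_position a) (extremal_position b) (extremal_position c) (extremal_position d)"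
proof -
  have "extremal_position u = extremal_position v" if "extremal_points ! u = extremal_points ! v" for u v
    using that by (simp add: extremal_position_def)
  then show ?thesis
    using assms unfolding segs_ok_def segs_ok_int_def cross_extremal of_int_mult[symmetric]
      of_int_0_less_iff of_int_eq_0_iff by blast
qed

lemma extremal_segs_ok:
  "\<forall>(a, b)\<in>set extremal_edges. \<forall>(c, d)\<in>set extremal_edges. (a, b) \<noteq> (c, d) \<longrightarrow>
     segs_ok_int (extremal_points ! a) (extremal_points ! b) (extremal_points ! c) (extremal_points ! d)"
  by code_simp

lemma planar_extremal: "planar extremal_graph"
proof (rule planar_straight_line[OF pair_graph_extremal, of extremal_position])
  have "distinct extremal_points" "length extremal_points = 11" by code_simp+
  moreover have "extremal_position u = extremal_position v \<longleftrightarrow> extremal_points ! u = extremal_points ! v" for u v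
    by (auto simp: extremal_position_def split: prod.splits)
  ultimately show "inj_on extremal_position (pverts extremal_graph)"
    by (auto simp: inj_on_def extremal_graph_def nth_eq_iff_index_eq)
  show "\<exists>w. adj extremal_graph v w" if "v \<in> pverts extremal_graph" for v
  proof -
    have "\<forall>v\<in>set [0..<11]. \<exists>e\<in>set extremal_edges. fst e = v \<or> snd e = v" by code_simp
    then show ?thesis using that by (force simp: extremal_graph_def)
  qed
  fix a b c d
  assume *: "adj extremal_graph a b" "adj extremal_graph c d" "a < b" "c < d" "(a, b) \<noteq> (c, d)"
  \<comment> \<open>Since listed pairs are increasing, an arc with \<open>a < b\<close> comes from
    the list and not from its converse.\<close>
  have "\<forall>e\<in>set extremal_edges. fst e < snd e" by code_simp
  then have "(a, b) \<in> set extremal_edges" "(c, d) \<in> set extremal_edges"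
    using * by (auto simp: extremal_graph_def)
  then show "segs_ok (extremal_position a) (extremal_position b) (extremal_position c) (extremal_position d)"
    using extremal_segs_ok *(5) by (intro segs_ok_extremal) fast
qed

section \<open>The defective chromatic number of the extremal graph\<close>

lemma not_cherryD: "\<not> cherry E S \<Longrightarrow> E v i \<Longrightarrow> E v k \<Longrightarrow> i \<noteq> k \<Longrightarrow> \<not> (v \<in> S \<and> i \<in> S \<and> k \<in> S)"
  unfolding cherry_def by blast

text \<open>If 0 and 1 had different colours, each of 4, 5, 6 would agree with one of them, giving
  that one two neighbours of its colour; so 0 and 1 agree. If 0 and 2 differ, then 7 and 8 give each
  of them a neighbour of its own colour; likewise 9 and 10 for 1 and 3. Each way to colour 2 and 3
  then yields a cherry, centred at 3 if both agree with 0, at 0 if only 3 does, at 1 if only 2 does,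
  and at 2 if neither does.\<close>

lemma extremal_not_2_colourable: "\<not> defective_colourable 2 1 extremal_graph"
proof
  assume "defective_colourable 2 1 extremal_graph"
  then obtain A where A: "\<not> cherry (adj extremal_graph) A" "\<not> cherry (adj extremal_graph) (pverts extremal_graph - A)"
    unfolding defective_colourable_2_1_iff[OF pair_graph_extremal] by blast
  \<comment> \<open>Restricting to neighbour lists reduces the two conditions to propositional
    clauses about membership in \<open>A\<close>.\<close>
  define N where "N v = filter (adj extremal_graph v) [0..<11]" for v
  have "\<forall>v\<in>set [0..<11]. \<forall>i\<in>set (N v). \<forall>k\<in>set (N v). i < k \<longrightarrow>
      \<not> (v \<in> A \<and> i \<in> A \<and> k \<in> A) \<and> \<not> (v \<notin> A \<and> i \<notin> A \<and> k \<notin> A)"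
    using not_cherryD[OF A(1)] not_cherryD[OF A(2)] by (auto simp: N_def extremal_graph_def)
  then show False
    by (simp add: N_def extremal_graph_def extremal_edges_def upt_rec) sat
qed

lemma extremal_3_colourable: "defective_colourable 3 1 extremal_graph"
  unfolding defective_colourable_1_iff[OF pair_graph_extremal]
  \<comment> \<open>The class of 0, 1, 2 contains only the edge 1-2, vertex 3 is alone, and 4 to 10
    are pairwise non-adjacent.\<close>
  by (intro exI[of _ "\<lambda>v. if v \<le> 2 then 0 else if v = 3 then 1 else 2"])
     (auto simp: cherry_def extremal_graph_def extremal_edges_def)

lemma defective_chromatic_number_extremal: "defective_chromatic_number 1 extremal_graph = 3"
  unfolding defective_chromatic_number_def
proof (rule Least_equality)
  show "defective_colourable 3 1 extremal_graph" by (rule extremal_3_colourable)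
  fix m assume "defective_colourable m 1 extremal_graph"
  \<comment> \<open>A colouring with fewer than three colours would also count as one with
    two.\<close>
  then show "3 \<le> m"
    using defective_colourable_mono[of m 1 extremal_graph 2] extremal_not_2_colourable by force
qed

section \<open>The minimum order\<close>

lemma order_ge_11:
  assumes G: "pair_graph G" and tri: "triangle_free G" and pl: "planar G"
    and chi: "defective_chromatic_number 1 G = 3"
  shows "11 \<le> card (pverts G)"
proof (rule ccontr)
  assume "\<not> 11 \<le> card (pverts G)"
  then have "card (pverts G) \<le> 10" by simp
  moreover have "\<not> (adj G u v \<and> adj G v w \<and> adj G u w)" for u v w
    using tri unfolding triangle_free_iff[OF G] by blast
  ultimately have "\<exists>A\<subseteq>pverts G. \<not> cherry (adj G) A \<and> \<not> cherry (adj G) (pverts G - A)"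
    by (intro two_colourable_upto_10 pair_graph_finite[OF G] pair_graph_wf[OF G] pair_graph_sym[OF G]
        pair_graph_irrefl[OF G] planar_no_K33_subdivision[OF pl])
  then have "defective_colourable 2 1 G"
    unfolding defective_colourable_2_1_iff[OF G] .
  then have "defective_chromatic_number 1 G \<le> 2"
    unfolding defective_chromatic_number_def by (rule Least_le)
  with chi show False by simp
qed

theorem theorem4p2:
  shows "(\<exists>G :: nat pair_pre_digraph. pair_graph G \<and> triangle_free G \<and> planar G
            \<and> defective_chromatic_number 1 G = 3 \<and> card (pverts G) = 11)
       \<and> (\<forall>G :: 'a pair_pre_digraph. pair_graph G \<and> triangle_free G \<and> planar G
            \<and> defective_chromatic_number 1 G = 3 \<longrightarrow> 11 \<le> card (pverts G))
       \<and> f_planar 3 1 = 11"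
proof (intro conjI)
  show ex: "\<exists>G :: nat pair_pre_digraph. pair_graph G \<and> triangle_free G \<and> planar G
      \<and> defective_chromatic_number 1 G = 3 \<and> card (pverts G) = 11"
    using pair_graph_extremal triangle_free_extremal planar_extremal defective_chromatic_number_extremal
    by (intro exI[of _ extremal_graph]) (simp add: extremal_graph_def)
  show "\<forall>G :: 'a pair_pre_digraph. pair_graph G \<and> triangle_free G \<and> planar G
      \<and> defective_chromatic_number 1 G = 3 \<longrightarrow> 11 \<le> card (pverts G)"
    using order_ge_11 by blast
  show "f_planar 3 1 = 11"
    unfolding f_planar_def
  proof (rule Least_equality)
    show "\<exists>G :: nat pair_pre_digraph. pair_graph G \<and> triangle_free G \<and> planar G
        \<and> defective_chromatic_number 1 G = 3 \<and> card (pverts G) = 11" by (rule ex)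
  qed (use order_ge_11 in blast)
qed

end
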